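(* Let $P=\{p_k\}_{k\ge1}$ be a system of Beurling generalized primes with associated generalized integers $\{n_k\}_{k\ge1}$, counting function $N(x)=\sum_{n_k<x}1$ and Chebyshev function $\psi(x)=\sum_{n_k<x}\Lambda(n_k)$. Suppose there is a constant $a>0$ such that $$\int_{1}^{\infty}\left|\frac{N(x)-ax}{x}\right|\frac{\mathrm{d}x}{x}<\infty$$ and $$N(x)=ax+o\!\left(\frac{x}{\log x}\right),\qquad x\to\infty .$$ Then $$0<\liminf_{x\to\infty}\frac{\psi(x)}{x}\quad\text{and}\quad\limsup_{x\to\infty}\frac{\psi(x)}{x}<\infty .$$
   Context: A system of Beurling generalized primes is a non-decreasing sequence $P=\{p_k\}_{k\ge1}$ of real numbers with $p_1>1$ and $p_k\to\infty$. The associated generalized integers $\{n_k\}_{k\ge1}$ are all finite products $p_{k_1}^{\alpha_1}\cdots p_{k_m}^{\alpha_m}$ (with $\alpha_j\geq 0$ integers), arranged in non-decreasing order and counted with multiplicity (i.e. according to the number of distinct ways of writing them as such products, distinct indices counting as distinct primes even if equal as real numbers). The generalized von Mangoldt function $\Lambda$ is defined so that $\psi(x)=\sum_{n_k<x}\Lambda(n_k)=\sum_{(k,j):\,p_k^j<x,\ j\ge1}\log p_k$. *)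

theory Defs
  imports "HOL-Analysis.Analysis" "HOL-Library.Landau_Symbols" "HOL-Library.Liminf_Limsup"
begin

definition beurling_primes :: "(nat \<Rightarrow> real) \<Rightarrow> bool" where
  "beurling_primes p \<longleftrightarrow> mono p \<and> p 0 > 1 \<and> filterlim p at_top sequentially"

text \<open>Generalized integers counted with multiplicity: they correspond to finitely
  supported exponent vectors alpha, the integer being the product of p k ^ alpha k.\<close>
definition gen_int :: "(nat \<Rightarrow> real) \<Rightarrow> (nat \<Rightarrow> nat) \<Rightarrow> real" where
  "gen_int p \<alpha> = (\<Prod>k\<in>{k. \<alpha> k \<noteq> 0}. p k ^ \<alpha> k)"

definition beurling_N :: "(nat \<Rightarrow> real) \<Rightarrow> real \<Rightarrow> real" where
  "beurling_N p x = real (card {\<alpha>::nat \<Rightarrow> nat. finite {k. \<alpha> k \<noteq> 0} \<and> gen_int p \<alpha> < x})"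

definition beurling_psi :: "(nat \<Rightarrow> real) \<Rightarrow> real \<Rightarrow> real" where
  "beurling_psi p x = (\<Sum>(k, j)\<in>{(k, j). j \<ge> 1 \<and> p k ^ j < x}. ln (p k))"

end

theory Submission
  imports Defs
begin

text \<open>In the variable \<open>u = log x\<close> put \<open>F u = N(e^u) / (a e^u) = 1 + E u\<close>, so that \<open>E\<close> is in
  \<open>L^1\<close> and \<open>u E u\<close> is bounded on the positive half-line, and let \<open>\<mu>\<close> be the measure with mass
  \<open>\<Lambda>(n)/n\<close> at \<open>log n\<close>.  The identity \<open>log \<cdot> dN = dN * d\<psi>\<close> says that \<open>F * \<mu> = u + O(1)\<close>, whence
  \<open>\<mu>(-\<infinity>,u) = u + O(1) - (E * \<mu>)(u)\<close>.  Integrate this against the derivative of the Laplace density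
  \<open>k v = b/2 exp (-b |v|)\<close>.  Since \<open>|k'| = b k\<close>, the error term becomes at most
  \<open>O(b) + b \<integral> |E z| (k * \<mu>)(y - z) dz\<close>, which for small \<open>b\<close> is absorbed by \<open>(k * \<mu>)(y)\<close>.
  Hence \<open>k * \<mu>\<close> is bounded, and as the main term is at least \<open>1/2\<close>, it is also bounded away from 0.
  Chebyshev's bounds for \<open>\<psi>\<close> follow by comparing \<open>k\<close> with \<open>exp (-v)\<close> on the half-line.\<close>

section \<open>Measures that are finite on left half-lines\<close>

lemma emeasure_lessThan_eq_nn_integral:
  fixes \<nu> :: "real measure"
  assumes "sets \<nu> = sets borel"
  shows "emeasure \<nu> {..<u} = (\<integral>\<^sup>+x. (if x < u then 1 else 0) \<partial>\<nu>)"
proof -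
  have "emeasure \<nu> {..<u} = (\<integral>\<^sup>+x. indicator {..<u} x \<partial>\<nu>)"
    using assms by simp
  also have "\<dots> = (\<integral>\<^sup>+x. (if x < u then 1 else 0) \<partial>\<nu>)"
    by (intro nn_integral_cong) simp
  finally show ?thesis .
qed

lemma emeasure_Int_greaterThan_eq_nn_integral:
  fixes M :: "real measure"
  assumes "sets M = sets borel" "A \<in> sets borel"
  shows "emeasure M (A \<inter> {x<..}) = (\<integral>\<^sup>+u\<in>A. (if x < u then 1 else 0) \<partial>M)"
proof -
  have "emeasure M (A \<inter> {x<..}) = (\<integral>\<^sup>+u. indicator (A \<inter> {x<..}) u \<partial>M)"
    using assms by simp
  also have "\<dots> = (\<integral>\<^sup>+u\<in>A. (if x < u then 1 else 0) \<partial>M)"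
    by (intro nn_integral_cong) (simp split: split_indicator)
  finally show ?thesis .
qed

lemma borel_measurable_emeasure_Int_greaterThan:
  fixes M :: "real measure"
  assumes M: "sigma_finite_measure M" "sets M = sets borel" and [measurable]: "A \<in> sets borel"
  shows "(\<lambda>x. emeasure M (A \<inter> {x<..})) \<in> borel_measurable borel"
proof -
  interpret sigma_finite_measure M by fact
  note [measurable_cong] = M(2)
  show ?thesis
    by (simp add: emeasure_Int_greaterThan_eq_nn_integral[OF M(2)])
qed

lemma nn_integral_emeasure_lessThan:
  fixes M \<nu> :: "real measure"
  assumes M: "sigma_finite_measure M" "sets M = sets borel"
    and \<nu>: "sigma_finite_measure \<nu>" "sets \<nu> = sets borel"
    and A [measurable]: "A \<in> sets borel"
  shows "(\<integral>\<^sup>+u\<in>A. emeasure \<nu> {..<u} \<partial>M) = (\<integral>\<^sup>+x. emeasure M (A \<inter> {x<..}) \<partial>\<nu>)"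
proof -
  interpret M: sigma_finite_measure M by fact
  interpret \<nu>: sigma_finite_measure \<nu> by fact
  interpret pair_sigma_finite M \<nu> ..
  note [measurable_cong] = M(2) \<nu>(2)
  have "(\<integral>\<^sup>+u\<in>A. emeasure \<nu> {..<u} \<partial>M)
      = (\<integral>\<^sup>+u. (\<integral>\<^sup>+x. (if x < u then 1 else 0) * indicator A u \<partial>\<nu>) \<partial>M)"
    by (subst nn_integral_multc) (simp_all add: emeasure_lessThan_eq_nn_integral[OF \<nu>(2)])
  also have "\<dots> = (\<integral>\<^sup>+x. (\<integral>\<^sup>+u\<in>A. (if x < u then 1 else 0) \<partial>M) \<partial>\<nu>)"
    by (rule Fubini'[symmetric]) measurable
  finally show ?thesis
    by (simp only: emeasure_Int_greaterThan_eq_nn_integral[OF M(2) A])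
qed

locale left_finite_measure =
  fixes M :: "real measure"
  assumes sets_eq_borel [measurable_cong]: "sets M = sets borel"
    and emeasure_lessThan_finite: "emeasure M {..<u} < \<infinity>"
begin

sublocale sigma_finite_measure M
proof
  let ?A = "range (\<lambda>n::nat. {..<real n})"
  have "\<Union> ?A = space M"
    using reals_Archimedean2 sets_eq_imp_space_eq[OF sets_eq_borel] by auto
  moreover have "?A \<subseteq> sets M"
    by (auto simp: sets_eq_borel)
  moreover have "\<forall>A\<in>?A. emeasure M A \<noteq> \<infinity>"
    using emeasure_lessThan_finite by (auto simp: less_top[symmetric])
  ultimately show "\<exists>A. countable A \<and> A \<subseteq> sets M \<and> \<Union> A = space M \<and> (\<forall>a\<in>A. emeasure M a \<noteq> \<infinity>)"
    by (intro exI[of _ ?A]) simp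
qed

lemma borel_measurable_emeasure_lessThan [measurable]:
  "(\<lambda>u. emeasure M {..<u}) \<in> borel_measurable borel"
  unfolding emeasure_lessThan_eq_nn_integral[OF sets_eq_borel] by measurable

end

definition lborel_pos :: "real measure" where
  "lborel_pos = density lborel (indicator {0<..})"

lemma sets_lborel_pos [simp, measurable_cong]: "sets lborel_pos = sets borel"
  by (simp add: lborel_pos_def)

lemma emeasure_lborel_pos_lessThan: "emeasure lborel_pos {..<u} = ennreal (max 0 u)"
proof -
  have "emeasure lborel_pos {..<u} = emeasure lborel ({0<..} \<inter> {..<u})"
    unfolding lborel_pos_def by (rule emeasure_restricted) auto
  also have "\<dots> = emeasure lborel {0<..<u}"
    by (simp add: greaterThanLessThan_def)
  also have "\<dots> = ennreal (max 0 u)"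
    by (cases "u \<ge> 0") auto
  finally show ?thesis .
qed

lemma left_finite_measure_lborel_pos: "left_finite_measure lborel_pos"
  by unfold_locales (simp_all add: emeasure_lborel_pos_lessThan)

section \<open>The Laplace distribution\<close>

definition laplace_density :: "real \<Rightarrow> real \<Rightarrow> real" where
  "laplace_density b x = b / 2 * exp (- b * \<bar>x\<bar>)"

lemma laplace_density_measurable [measurable]: "laplace_density b \<in> borel_measurable borel"
  unfolding laplace_density_def by measurable

lemma laplace_density_nonneg: "b \<ge> 0 \<Longrightarrow> laplace_density b x \<ge> 0"
  by (simp add: laplace_density_def)

definition laplace_measure :: "real \<Rightarrow> real \<Rightarrow> real measure" where
  "laplace_measure b y = density lborel (\<lambda>u. ennreal (laplace_density b (y - u)))"

lemma sets_laplace_measure [simp, measurable_cong]: "sets (laplace_measure b y) = sets borel"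
  by (simp add: laplace_measure_def)

lemma space_laplace_measure [simp]: "space (laplace_measure b y) = UNIV"
  by (simp add: laplace_measure_def)

lemma emeasure_laplace_measure:
  "A \<in> sets borel \<Longrightarrow>
    emeasure (laplace_measure b y) A = (\<integral>\<^sup>+u\<in>A. ennreal (laplace_density b (y - u)) \<partial>lborel)"
  unfolding laplace_measure_def by (rule emeasure_density) auto

lemma emeasure_laplace_measure_atLeast:
  assumes "b > 0" "y \<le> x"
  shows "emeasure (laplace_measure b y) {x..} = ennreal (exp (- b * (x - y)) / 2)"
proof -
  have "emeasure (laplace_measure b y) {x..}
      = (\<integral>\<^sup>+u\<in>{x..}. ennreal (b / 2 * exp (- b * (u - y))) \<partial>lborel)"
    using assms
    by (auto simp: emeasure_laplace_measure laplace_density_def intro!: nn_integral_cong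
        split: split_indicator)
  also have "\<dots> = ennreal (0 - (- exp (- b * (x - y)) / 2))"
  proof (rule nn_integral_FTC_atLeast)
    show "((\<lambda>u. - exp (- b * (u - y)) / 2) \<longlongrightarrow> 0) at_top"
    proof -
      have "filterlim (\<lambda>u. u - y) at_top at_top"
        using filterlim_tendsto_add_at_top[OF tendsto_const[of "- y"] filterlim_ident] by simp
      then have "filterlim (\<lambda>u. - (b * (u - y))) at_bot at_top"
        using filterlim_tendsto_pos_mult_at_top[OF tendsto_const assms(1)]
        by (simp add: filterlim_uminus_at_bot)
      then have "((\<lambda>u. exp (- (b * (u - y)))) \<longlongrightarrow> 0) at_top"
        by (rule filterlim_compose[OF exp_at_bot])
      then show ?thesis
        using tendsto_mult_left[of _ 0 _ "- 1 / 2"] by fastforce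
    qed
  qed (use assms in \<open>auto intro!: derivative_eq_intros\<close>)
  finally show ?thesis
    by simp
qed

lemma emeasure_laplace_measure_greaterThan:
  assumes "b > 0" "y \<le> x"
  shows "emeasure (laplace_measure b y) {x<..} = ennreal (exp (- b * (x - y)) / 2)"
proof -
  have "emeasure (laplace_measure b y) {x<..} = emeasure (laplace_measure b y) {x..}"
    using AE_lborel_singleton[of x]
    by (auto simp: emeasure_laplace_measure intro!: nn_integral_cong_AE split: split_indicator)
  with assms show ?thesis
    by (simp add: emeasure_laplace_measure_atLeast)
qed

lemma emeasure_laplace_measure_greaterThanAtMost:
  assumes "b > 0" "x \<le> y"
  shows "emeasure (laplace_measure b y) {x<..y} = ennreal ((1 - exp (- b * (y - x))) / 2)"
proof -
  have "emeasure (laplace_measure b y) {x<..y}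
      = (\<integral>\<^sup>+u\<in>{x..y}. ennreal (b / 2 * exp (- b * (y - u))) \<partial>lborel)"
    using AE_lborel_singleton[of x]
    by (auto simp: emeasure_laplace_measure laplace_density_def intro!: nn_integral_cong_AE
        split: split_indicator)
  also have "\<dots> = ennreal (exp (- b * (y - y)) / 2 - exp (- b * (y - x)) / 2)"
    by (rule nn_integral_FTC_Icc[where F="\<lambda>u. exp (- b * (y - u)) / 2"])
      (use assms in \<open>auto intro!: derivative_eq_intros\<close>)
  finally show ?thesis
    by (simp add: diff_divide_distrib)
qed

lemma emeasure_laplace_measure_atMost_center:
  assumes "b > 0"
  shows "emeasure (laplace_measure b y) {..y} = ennreal (1 / 2)"
proof -
  let ?f = "\<lambda>u. ennreal (laplace_density b (y - u))"
  have "emeasure (laplace_measure b y) {..y}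
      = ennreal \<bar>-1\<bar> * (\<integral>\<^sup>+u. ?f (2 * y + -1 * u) * indicator {..y} (2 * y + -1 * u) \<partial>lborel)"
    by (subst emeasure_laplace_measure) (simp, rule nn_integral_real_affine, auto)
  also have "\<dots> = (\<integral>\<^sup>+u\<in>{y..}. ?f u \<partial>lborel)"
    by (auto intro!: nn_integral_cong simp: laplace_density_def split: split_indicator)
  also have "\<dots> = ennreal (1 / 2)"
    using emeasure_laplace_measure_atLeast[OF assms order_refl]
    by (simp add: emeasure_laplace_measure)
  finally show ?thesis .
qed

lemma emeasure_laplace_measure_UNIV:
  assumes "b > 0"
  shows "emeasure (laplace_measure b y) UNIV = 1"
proof -
  have "emeasure (laplace_measure b y) UNIV
      = emeasure (laplace_measure b y) ({..y} \<union> {y<..})"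
    by (rule arg_cong[where f="emeasure _"]) auto
  also have "\<dots> = emeasure (laplace_measure b y) {..y} + emeasure (laplace_measure b y) {y<..}"
    by (rule plus_emeasure[symmetric]) auto
  also have "\<dots> = ennreal (1 / 2) + ennreal (1 / 2)"
    using assms
    by (simp add: emeasure_laplace_measure_atMost_center emeasure_laplace_measure_greaterThan)
  also have "\<dots> = 1"
    by (subst ennreal_plus[symmetric]) simp_all
  finally show ?thesis .
qed

section \<open>Convolution with the Laplace density\<close>

definition laplace_conv :: "real \<Rightarrow> real measure \<Rightarrow> real \<Rightarrow> ennreal" where
  "laplace_conv b \<nu> y = (\<integral>\<^sup>+x. ennreal (laplace_density b (y - x)) \<partial>\<nu>)"

lemma laplace_density_plus_emeasure_laplace_measure:
  assumes "b > 0"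
  shows "ennreal (laplace_density b (y - x)) + ennreal b * emeasure (laplace_measure b y) {x<..y}
      = ennreal b * emeasure (laplace_measure b y) {max x y<..}"
proof (cases "x \<le> y")
  case True
  have "ennreal (laplace_density b (y - x)) + ennreal b * emeasure (laplace_measure b y) {x<..y}
      = ennreal (laplace_density b (y - x) + b * ((1 - exp (- b * (y - x))) / 2))"
    using True assms laplace_density_nonneg[of b "y - x"]
    by (simp add: emeasure_laplace_measure_greaterThanAtMost flip: ennreal_mult ennreal_plus)
  also have "laplace_density b (y - x) + b * ((1 - exp (- b * (y - x))) / 2) = b * (1 / 2)"
    using True by (simp add: laplace_density_def field_simps)
  also have "ennreal (b * (1 / 2)) = ennreal b * emeasure (laplace_measure b y) {max x y<..}"
    using True assms
    by (subst ennreal_mult) (simp_all add: emeasure_laplace_measure_greaterThan max_absorb2)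
  finally show ?thesis .
next
  case False
  with assms show ?thesis
    by (simp add: emeasure_laplace_measure_greaterThan laplace_density_def max_absorb1
        flip: ennreal_mult)
qed

text \<open>The derivative of the kernel is \<open>b\<close> times the kernel to the left of its centre and \<open>- b\<close> times
  the kernel to the right; moving the negative part to the other side keeps the identity
  meaningful in \<^typ>\<open>ennreal\<close>.\<close>

lemma (in left_finite_measure) laplace_conv_by_parts:
  assumes "b > 0"
  shows "laplace_conv b M y + ennreal b * (\<integral>\<^sup>+u\<in>{..y}. emeasure M {..<u} \<partial>laplace_measure b y)
      = ennreal b * (\<integral>\<^sup>+u\<in>{y<..}. emeasure M {..<u} \<partial>laplace_measure b y)"
proof -
  let ?L = "laplace_measure b y"
  have L: "sigma_finite_measure ?L"
    by (rule finite_measure.axioms, rule finite_measureI)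
      (simp add: emeasure_laplace_measure_UNIV[OF assms])
  note layer_cake = nn_integral_emeasure_lessThan[OF L sets_laplace_measure
      sigma_finite_measure_axioms sets_eq_borel]
  note [measurable] = borel_measurable_emeasure_Int_greaterThan[OF L sets_laplace_measure]
  have Int_greaterThan: "{..y} \<inter> {x<..} = {x<..y}" "{y<..} \<inter> {x<..} = {max x y<..}" for x
    by auto
  have "laplace_conv b M y + ennreal b * (\<integral>\<^sup>+x. emeasure ?L ({..y} \<inter> {x<..}) \<partial>M)
      = (\<integral>\<^sup>+x. ennreal (laplace_density b (y - x)) + ennreal b * emeasure ?L ({..y} \<inter> {x<..}) \<partial>M)"
    unfolding laplace_conv_def by (simp add: nn_integral_add nn_integral_cmult)
  also have "\<dots> = (\<integral>\<^sup>+x. ennreal b * emeasure ?L ({y<..} \<inter> {x<..}) \<partial>M)"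
    by (simp only: Int_greaterThan laplace_density_plus_emeasure_laplace_measure[OF assms])
  also have "\<dots> = ennreal b * (\<integral>\<^sup>+x. emeasure ?L ({y<..} \<inter> {x<..}) \<partial>M)"
    by (rule nn_integral_cmult) measurable
  finally show ?thesis
    by (simp add: layer_cake)
qed

lemma laplace_conv_add_below_le:
  assumes \<nu>: "left_finite_measure \<nu>" and \<nu>': "left_finite_measure \<nu>'" and b: "b > 0"
    and [measurable]: "e \<in> borel_measurable borel"
    and le: "\<And>u. emeasure \<nu> {..<u} \<le> emeasure \<nu>' {..<u} + e u"
  shows "laplace_conv b \<nu> y + ennreal b * (\<integral>\<^sup>+u\<in>{..y}. emeasure \<nu> {..<u} \<partial>laplace_measure b y)
      \<le> laplace_conv b \<nu>' y + ennreal b * (\<integral>\<^sup>+u\<in>{..y}. emeasure \<nu>' {..<u} \<partial>laplace_measure b y)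
        + ennreal b * (\<integral>\<^sup>+u\<in>{y<..}. e u \<partial>laplace_measure b y)"
proof -
  note [measurable] = left_finite_measure.borel_measurable_emeasure_lessThan[OF \<nu>']
  have "(\<integral>\<^sup>+u\<in>{y<..}. emeasure \<nu> {..<u} \<partial>laplace_measure b y)
      \<le> (\<integral>\<^sup>+u\<in>{y<..}. emeasure \<nu>' {..<u} + e u \<partial>laplace_measure b y)"
    by (intro nn_integral_mono mult_right_mono le) simp
  also have "\<dots> = (\<integral>\<^sup>+u\<in>{y<..}. emeasure \<nu>' {..<u} \<partial>laplace_measure b y)
      + (\<integral>\<^sup>+u\<in>{y<..}. e u \<partial>laplace_measure b y)"
    by (simp add: distrib_right nn_integral_add)
  finally show ?thesis
    unfolding left_finite_measure.laplace_conv_by_parts[OF \<nu> b]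
      left_finite_measure.laplace_conv_by_parts[OF \<nu>' b]
    by (simp flip: distrib_left add: mult_left_mono)
qed

lemma (in left_finite_measure) nn_integral_emeasure_lessThan_atMost_le:
  assumes "b > 0"
  shows "(\<integral>\<^sup>+u\<in>{..y}. emeasure M {..<u} \<partial>laplace_measure b y) \<le> emeasure M {..<y}"
proof -
  have "(\<integral>\<^sup>+u\<in>{..y}. emeasure M {..<u} \<partial>laplace_measure b y)
      \<le> (\<integral>\<^sup>+u. emeasure M {..<y} \<partial>laplace_measure b y)"
    by (intro nn_integral_mono)
      (auto intro!: emeasure_mono simp: sets_eq_borel split: split_indicator)
  also have "\<dots> = emeasure M {..<y}"
    using emeasure_laplace_measure_UNIV[OF assms] by simp
  finally show ?thesis .
qed

lemma laplace_conv_le_of_emeasure_le: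
  assumes \<nu>: "left_finite_measure \<nu>" and \<nu>': "left_finite_measure \<nu>'" and b: "b > 0"
    and le: "\<And>u. emeasure \<nu> {..<u} \<le> emeasure \<nu>' {..<u} + c"
  shows "laplace_conv b \<nu> y \<le> laplace_conv b \<nu>' y + ennreal b * (emeasure \<nu>' {..<y} + c)"
proof -
  have "(\<integral>\<^sup>+u\<in>{y<..}. c \<partial>laplace_measure b y) \<le> (\<integral>\<^sup>+u. c \<partial>laplace_measure b y)"
    by (intro nn_integral_mono) (simp split: split_indicator)
  also have "\<dots> = c"
    using emeasure_laplace_measure_UNIV[OF b] by simp
  finally have above: "(\<integral>\<^sup>+u\<in>{y<..}. c \<partial>laplace_measure b y) \<le> c" .
  have "laplace_conv b \<nu> y
      \<le> laplace_conv b \<nu> y + ennreal b * (\<integral>\<^sup>+u\<in>{..y}. emeasure \<nu> {..<u} \<partial>laplace_measure b y)"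
    by simp
  also have "\<dots> \<le> laplace_conv b \<nu>' y
      + ennreal b * (\<integral>\<^sup>+u\<in>{..y}. emeasure \<nu>' {..<u} \<partial>laplace_measure b y)
      + ennreal b * (\<integral>\<^sup>+u\<in>{y<..}. c \<partial>laplace_measure b y)"
    by (rule laplace_conv_add_below_le[OF \<nu> \<nu>' b _ le]) simp
  also have "\<dots> \<le> laplace_conv b \<nu>' y + ennreal b * emeasure \<nu>' {..<y} + ennreal b * c"
    by (intro add_mono mult_left_mono order_refl above
        left_finite_measure.nn_integral_emeasure_lessThan_atMost_le[OF \<nu>' b]) auto
  finally show ?thesis
    by (simp add: distrib_left add.assoc)
qed

lemma laplace_conv_le_of_emeasure_approx:
  assumes \<nu>: "left_finite_measure \<nu>" and \<nu>': "left_finite_measure \<nu>'" and b: "b > 0"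
    and e [measurable]: "e \<in> borel_measurable borel"
    and le: "\<And>u. emeasure \<nu> {..<u} \<le> emeasure \<nu>' {..<u} + e u"
    and ge: "\<And>u. emeasure \<nu>' {..<u} \<le> emeasure \<nu> {..<u} + e u"
  shows "laplace_conv b \<nu> y \<le> laplace_conv b \<nu>' y + ennreal b * (\<integral>\<^sup>+u. e u \<partial>laplace_measure b y)"
proof -
  let ?L = "laplace_measure b y"
  let ?below = "\<lambda>h. ennreal b * (\<integral>\<^sup>+u\<in>{..y}. h u \<partial>?L)"
  let ?above = "\<lambda>h. ennreal b * (\<integral>\<^sup>+u\<in>{y<..}. h u \<partial>?L)"
  let ?P = "\<lambda>u. emeasure \<nu> {..<u}" and ?P' = "\<lambda>u. emeasure \<nu>' {..<u}"
  note [measurable] = left_finite_measure.borel_measurable_emeasure_lessThan[OF \<nu>]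
  have "?below ?P' \<le> ?below (\<lambda>u. ?P u + e u)"
    by (intro mult_left_mono nn_integral_mono mult_right_mono ge) simp_all
  also have "\<dots> = ?below ?P + ?below e"
    by (simp add: distrib_right nn_integral_add distrib_left)
  finally have below: "?below ?P' \<le> ?below ?P + ?below e" .
  have "(\<integral>\<^sup>+u\<in>{..y}. e u \<partial>?L) + (\<integral>\<^sup>+u\<in>{y<..}. e u \<partial>?L) = (\<integral>\<^sup>+u\<in>{..y} \<union> {y<..}. e u \<partial>?L)"
    by (rule nn_integral_disjoint_pair[symmetric]) auto
  also have "{..y} \<union> {y<..} = UNIV"
    by auto
  finally have split: "?below e + ?above e = ennreal b * (\<integral>\<^sup>+u. e u \<partial>?L)"
    by (simp flip: distrib_left)
  have "?below ?P + laplace_conv b \<nu> y \<le> laplace_conv b \<nu>' y + ?below ?P' + ?above e"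
    using laplace_conv_add_below_le[OF \<nu> \<nu>' b e le] by (simp add: add.commute)
  also have "\<dots> \<le> laplace_conv b \<nu>' y + (?below ?P + ?below e) + ?above e"
    by (intro add_mono order_refl below)
  also have "\<dots> = ?below ?P + (laplace_conv b \<nu>' y + (?below e + ?above e))"
    by (simp add: ac_simps)
  finally have "?below ?P + laplace_conv b \<nu> y
      \<le> ?below ?P + (laplace_conv b \<nu>' y + ennreal b * (\<integral>\<^sup>+u. e u \<partial>?L))"
    by (simp only: split)
  moreover have "?below ?P \<noteq> \<infinity>"
    using left_finite_measure.nn_integral_emeasure_lessThan_atMost_le[OF \<nu> b, of y]
      left_finite_measure.emeasure_lessThan_finite[OF \<nu>, of y]
    by (auto simp: ennreal_mult_eq_top_iff top_unique)
  ultimately show ?thesis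
    by (simp only: ennreal_add_left_cancel_le) blast
qed

lemma laplace_conv_lborel_pos:
  "laplace_conv b lborel_pos y = emeasure (laplace_measure b y) {0<..}"
  unfolding laplace_conv_def lborel_pos_def
  by (subst nn_integral_density) (simp_all add: emeasure_laplace_measure mult.commute)

lemma laplace_conv_lborel_pos_le_1: "b > 0 \<Longrightarrow> laplace_conv b lborel_pos y \<le> 1"
  using emeasure_mono[of "{0<..}" UNIV "laplace_measure b y"]
  by (simp add: laplace_conv_lborel_pos emeasure_laplace_measure_UNIV)

lemma laplace_conv_lborel_pos_ge_half:
  assumes "b > 0" "y \<ge> 0"
  shows "ennreal (1 / 2) \<le> laplace_conv b lborel_pos y"
proof -
  have "ennreal (1 / 2) = emeasure (laplace_measure b y) {y<..}"
    using assms(1) by (simp add: emeasure_laplace_measure_greaterThan)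
  also have "\<dots> \<le> emeasure (laplace_measure b y) {0<..}"
    using assms(2) by (intro emeasure_mono) auto
  finally show ?thesis
    by (simp only: laplace_conv_lborel_pos)
qed

lemma nn_integral_laplace_measure_convolution:
  assumes \<nu>: "sigma_finite_measure \<nu>" "sets \<nu> = sets borel"
    and [measurable]: "g \<in> borel_measurable borel"
  shows "(\<integral>\<^sup>+u. (\<integral>\<^sup>+v. g (u - v) \<partial>\<nu>) \<partial>laplace_measure b y)
      = (\<integral>\<^sup>+z. g z * laplace_conv b \<nu> (y - z) \<partial>lborel)"
proof -
  interpret sigma_finite_measure \<nu> by fact
  interpret pair_sigma_finite lborel \<nu> ..
  note [measurable_cong] = \<nu>(2)
  let ?k = "\<lambda>x. ennreal (laplace_density b x)"
  have "(\<integral>\<^sup>+u. (\<integral>\<^sup>+v. g (u - v) \<partial>\<nu>) \<partial>laplace_measure b y)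
      = (\<integral>\<^sup>+u. (\<integral>\<^sup>+v. ?k (y - u) * g (u - v) \<partial>\<nu>) \<partial>lborel)"
    unfolding laplace_measure_def by (simp add: nn_integral_density nn_integral_cmult)
  also have "\<dots> = (\<integral>\<^sup>+v. (\<integral>\<^sup>+u. ?k (y - u) * g (u - v) \<partial>lborel) \<partial>\<nu>)"
    by (rule Fubini'[symmetric]) measurable
  also have "\<dots> = (\<integral>\<^sup>+v. (\<integral>\<^sup>+z. g z * ?k (y - z - v) \<partial>lborel) \<partial>\<nu>)"
  proof (rule nn_integral_cong)
    fix v
    show "(\<integral>\<^sup>+u. ?k (y - u) * g (u - v) \<partial>lborel) = (\<integral>\<^sup>+z. g z * ?k (y - z - v) \<partial>lborel)"
      by (subst nn_integral_real_affine[where c=1 and t=v]) (simp_all add: algebra_simps)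
  qed
  also have "\<dots> = (\<integral>\<^sup>+z. (\<integral>\<^sup>+v. g z * ?k (y - z - v) \<partial>\<nu>) \<partial>lborel)"
    by (rule Fubini') measurable
  also have "\<dots> = (\<integral>\<^sup>+z. g z * laplace_conv b \<nu> (y - z) \<partial>lborel)"
    unfolding laplace_conv_def by (simp add: nn_integral_cmult)
  finally show ?thesis .
qed

definition exp_conv :: "real measure \<Rightarrow> real \<Rightarrow> ennreal" where
  "exp_conv \<nu> t = (\<integral>\<^sup>+x\<in>{..<t}. ennreal (exp (x - t)) \<partial>\<nu>)"

lemma exp_conv_le_laplace_conv:
  assumes "sets \<nu> = sets borel" "0 < b" "b \<le> 1"
  shows "exp_conv \<nu> t \<le> ennreal (2 / b) * laplace_conv b \<nu> t"
proof -
  note [measurable_cong] = assms(1)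
  have "exp_conv \<nu> t \<le> (\<integral>\<^sup>+x. ennreal (2 / b) * ennreal (laplace_density b (t - x)) \<partial>\<nu>)"
    unfolding exp_conv_def
  proof (rule nn_integral_mono)
    fix x
    have "exp (x - t) \<le> 2 / b * laplace_density b (t - x)" if "x < t"
    proof -
      have "b * (t - x) \<le> 1 * (t - x)"
        using assms that by (intro mult_right_mono) auto
      then have "exp (x - t) \<le> exp (- (b * (t - x)))"
        by (simp add: algebra_simps)
      then show ?thesis
        using assms that by (simp add: laplace_density_def)
    qed
    then show "ennreal (exp (x - t)) * indicator {..<t} x
        \<le> ennreal (2 / b) * ennreal (laplace_density b (t - x))"
      using assms by (simp add: ennreal_leI flip: ennreal_mult' split: split_indicator)
  qed
  also have "\<dots> = ennreal (2 / b) * laplace_conv b \<nu> t"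
    unfolding laplace_conv_def by (simp add: nn_integral_cmult)
  finally show ?thesis .
qed

lemma laplace_density_le_exp_add:
  assumes "b > 0"
  shows "laplace_density b (y - x)
      \<le> b / 2 * exp (2 * V) * (exp (x - (y + V)) * indicator {..<y + V} x)
        + 2 * exp (- (b / 2 * V)) * laplace_density (b / 2) (y - x)"
    (is "_ \<le> ?near + ?far")
proof (cases "\<bar>y - x\<bar> < V")
  case True
  have "exp (- b * \<bar>y - x\<bar>) \<le> 1"
    using assms by simp
  also have "1 \<le> exp (2 * V) * exp (x - (y + V))"
    using True by (simp flip: exp_add)
  finally have "laplace_density b (y - x) \<le> ?near"
    using True assms by (simp add: laplace_density_def)
  then show ?thesis
    using assms laplace_density_nonneg[of "b / 2"] by (simp add: add_increasing2)
next
  case False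
  then have "b / 2 * V \<le> b / 2 * \<bar>y - x\<bar>"
    using assms by (intro mult_left_mono) auto
  then have "exp (- b * \<bar>y - x\<bar>) \<le> exp (- (b / 2 * V)) * exp (- (b / 2) * \<bar>y - x\<bar>)"
    by (simp flip: exp_add)
  then have "laplace_density b (y - x) \<le> ?far"
    using assms by (simp add: laplace_density_def)
  then show ?thesis
    using assms by (simp add: add_increasing)
qed

lemma laplace_conv_le_exp_conv:
  assumes "sets \<nu> = sets borel" "b > 0"
  shows "laplace_conv b \<nu> y \<le> ennreal (b / 2 * exp (2 * V)) * exp_conv \<nu> (y + V)
      + ennreal (2 * exp (- (b / 2 * V))) * laplace_conv (b / 2) \<nu> y"
proof -
  note [measurable_cong] = assms(1)
  have "laplace_conv b \<nu> y
      \<le> (\<integral>\<^sup>+x. ennreal (b / 2 * exp (2 * V) * (exp (x - (y + V)) * indicator {..<y + V} x)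
          + 2 * exp (- (b / 2 * V)) * laplace_density (b / 2) (y - x)) \<partial>\<nu>)"
    unfolding laplace_conv_def
    by (intro nn_integral_mono ennreal_leI laplace_density_le_exp_add assms)
  also have "\<dots> = (\<integral>\<^sup>+x. ennreal (b / 2 * exp (2 * V))
        * (ennreal (exp (x - (y + V))) * indicator {..<y + V} x)
      + ennreal (2 * exp (- (b / 2 * V))) * ennreal (laplace_density (b / 2) (y - x)) \<partial>\<nu>)"
    using assms
    by (intro nn_integral_cong)
      (simp add: laplace_density_nonneg flip: ennreal_mult ennreal_plus split: split_indicator)
  also have "\<dots> = ennreal (b / 2 * exp (2 * V)) * exp_conv \<nu> (y + V)
      + ennreal (2 * exp (- (b / 2 * V))) * laplace_conv (b / 2) \<nu> y"
    unfolding exp_conv_def laplace_conv_def by (simp add: nn_integral_add nn_integral_cmult)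
  finally show ?thesis .
qed

section \<open>Measures with an approximate renewal equation\<close>

locale renewal_measure =
  fixes \<mu> :: "real measure" and F :: "real \<Rightarrow> real" and m B D :: real
  assumes sets_mu [measurable_cong]: "sets \<mu> = sets borel"
    and F_measurable [measurable]: "F \<in> borel_measurable borel"
    and F_nonpos: "z \<le> 0 \<Longrightarrow> F z = 0"
    and m_pos: "m > 0" and F_ge: "z > 0 \<Longrightarrow> m \<le> F z"
    and D_nonneg: "D \<ge> 0"
    and F_near_indicator: "(\<integral>\<^sup>+z. ennreal \<bar>F z - indicator {0<..} z\<bar> \<partial>lborel) \<le> ennreal D"
    and B_nonneg: "B \<ge> 0"
    and F_conv_le: "(\<integral>\<^sup>+v. ennreal (F (u - v)) \<partial>\<mu>) \<le> ennreal (max 0 u) + ennreal B"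
    and le_F_conv: "ennreal (max 0 u) \<le> (\<integral>\<^sup>+v. ennreal (F (u - v)) \<partial>\<mu>) + ennreal B"
begin

definition err :: "real \<Rightarrow> ennreal" where
  "err z = ennreal \<bar>F z - indicator {0<..} z\<bar>"

definition err_conv :: "real \<Rightarrow> ennreal" where
  "err_conv u = (\<integral>\<^sup>+v. err (u - v) \<partial>\<mu>)"

lemma err_measurable [measurable]: "err \<in> borel_measurable borel"
  unfolding err_def by measurable

lemma F_nonneg: "F z \<ge> 0"
  using F_nonpos[of z] F_ge[of z] m_pos by (cases "z \<le> 0") auto

lemma emeasure_mu_eq: "emeasure \<mu> {..<u} = (\<integral>\<^sup>+v. indicator {0<..} (u - v) \<partial>\<mu>)"
  unfolding emeasure_lessThan_eq_nn_integral[OF sets_mu]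
  by (intro nn_integral_cong) (simp split: split_indicator)

lemma scaled_emeasure_mu_le: "ennreal m * emeasure \<mu> {..<u} \<le> ennreal (max 0 u) + ennreal B"
proof -
  have "ennreal m * emeasure \<mu> {..<u} = (\<integral>\<^sup>+v. ennreal m * indicator {0<..} (u - v) \<partial>\<mu>)"
    unfolding emeasure_mu_eq by (simp add: nn_integral_cmult)
  also have "\<dots> \<le> (\<integral>\<^sup>+v. ennreal (F (u - v)) \<partial>\<mu>)"
    using F_ge by (intro nn_integral_mono) (auto split: split_indicator intro!: ennreal_leI)
  finally show ?thesis
    using F_conv_le by (rule order_trans)
qed

sublocale left_finite_measure \<mu>
proof
  fix u
  have "ennreal m * emeasure \<mu> {..<u} < \<infinity>"
    by (rule order_le_less_trans[OF scaled_emeasure_mu_le]) simp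
  then show "emeasure \<mu> {..<u} < \<infinity>"
    using m_pos by (auto simp: ennreal_mult_less_top)
qed (rule sets_mu)

lemma err_conv_measurable [measurable]: "err_conv \<in> borel_measurable borel"
  unfolding err_conv_def by measurable

lemma emeasure_mu_le_err_conv:
  "emeasure \<mu> {..<u} \<le> emeasure lborel_pos {..<u} + (ennreal B + err_conv u)"
proof -
  have "emeasure \<mu> {..<u} \<le> (\<integral>\<^sup>+v. ennreal (F (u - v)) + err (u - v) \<partial>\<mu>)"
    unfolding emeasure_mu_eq err_def
    by (intro nn_integral_mono)
      (simp add: F_nonneg ennreal_leI abs_real_def flip: ennreal_plus ennreal_1
        split: split_indicator)
  also have "\<dots> = (\<integral>\<^sup>+v. ennreal (F (u - v)) \<partial>\<mu>) + err_conv u"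
    unfolding err_conv_def by (simp add: nn_integral_add)
  also have "\<dots> \<le> ennreal (max 0 u) + ennreal B + err_conv u"
    by (intro add_right_mono F_conv_le)
  finally show ?thesis
    by (simp only: emeasure_lborel_pos_lessThan add.assoc)
qed

lemma emeasure_lborel_pos_le_err_conv:
  "emeasure lborel_pos {..<u} \<le> emeasure \<mu> {..<u} + (ennreal B + err_conv u)"
proof -
  have "(\<integral>\<^sup>+v. ennreal (F (u - v)) \<partial>\<mu>) \<le> (\<integral>\<^sup>+v. indicator {0<..} (u - v) + err (u - v) \<partial>\<mu>)"
    unfolding err_def
    by (intro nn_integral_mono)
      (simp add: F_nonpos ennreal_leI abs_real_def flip: ennreal_plus ennreal_1
        split: split_indicator)
  also have "\<dots> = emeasure \<mu> {..<u} + err_conv u"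
    unfolding err_conv_def emeasure_mu_eq by (simp add: nn_integral_add)
  finally have "ennreal (max 0 u) \<le> emeasure \<mu> {..<u} + err_conv u + ennreal B"
    using le_F_conv[of u] add_right_mono order_trans by blast
  then show ?thesis
    by (simp only: emeasure_lborel_pos_lessThan ac_simps)
qed

lemma laplace_conv_mu_growth:
  assumes "b > 0"
  shows "ennreal m * laplace_conv b \<mu> y \<le> ennreal (1 + b * (max 0 y + B))"
proof -
  have "ennreal m * laplace_conv b \<mu> y = laplace_conv b (scale_measure (ennreal m) \<mu>) y"
    unfolding laplace_conv_def by (simp add: nn_integral_scale_measure)
  also have "\<dots> \<le> laplace_conv b lborel_pos y + ennreal b * (emeasure lborel_pos {..<y} + ennreal B)"
  proof (rule laplace_conv_le_of_emeasure_le[OF _ left_finite_measure_lborel_pos assms])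
    show "left_finite_measure (scale_measure (ennreal m) \<mu>)"
      using emeasure_lessThan_finite
      by unfold_locales (simp_all add: sets_mu ennreal_mult_less_top)
  qed (simp add: emeasure_lborel_pos_lessThan scaled_emeasure_mu_le)
  also have "\<dots> \<le> 1 + ennreal b * (ennreal (max 0 y) + ennreal B)"
    by (simp only: emeasure_lborel_pos_lessThan)
      (intro add_right_mono laplace_conv_lborel_pos_le_1 assms)
  also have "\<dots> = ennreal (1 + b * (max 0 y + B))"
    using assms B_nonneg by (simp add: ennreal_mult)
  finally show ?thesis .
qed

lemma nn_integral_err_conv_le:
  assumes "b > 0" "R \<ge> 0" and le: "\<And>y'. y' \<le> y \<Longrightarrow> laplace_conv b \<mu> y' \<le> ennreal R"
  shows "(\<integral>\<^sup>+u. ennreal B + err_conv u \<partial>laplace_measure b y) \<le> ennreal (B + D * R)"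
proof -
  have "(\<integral>\<^sup>+u. err_conv u \<partial>laplace_measure b y) = (\<integral>\<^sup>+z. err z * laplace_conv b \<mu> (y - z) \<partial>lborel)"
    unfolding err_conv_def
    by (rule nn_integral_laplace_measure_convolution)
      (rule sigma_finite_measure_axioms sets_mu err_measurable)+
  also have "\<dots> \<le> (\<integral>\<^sup>+z. err z * ennreal R \<partial>lborel)"
  proof (rule nn_integral_mono)
    fix z
    show "err z * laplace_conv b \<mu> (y - z) \<le> err z * ennreal R"
      by (cases "z > 0") (simp_all add: mult_left_mono le, simp add: err_def F_nonpos)
  qed
  also have "\<dots> = (\<integral>\<^sup>+z. err z \<partial>lborel) * ennreal R"
    by (simp add: nn_integral_multc)
  also have "\<dots> \<le> ennreal D * ennreal R"
    using F_near_indicator unfolding err_def by (rule mult_right_mono) simp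
  finally have "ennreal B + (\<integral>\<^sup>+u. err_conv u \<partial>laplace_measure b y)
      \<le> ennreal B + ennreal D * ennreal R"
    by (rule add_left_mono)
  then show ?thesis
    using assms(2) B_nonneg D_nonneg emeasure_laplace_measure_UNIV[OF assms(1)]
    by (simp add: nn_integral_add ennreal_mult)
qed

lemma laplace_conv_mu_le_add:
  assumes "b > 0" "R \<ge> 0" "\<And>y'. y' \<le> y \<Longrightarrow> laplace_conv b \<mu> y' \<le> ennreal R"
  shows "laplace_conv b \<mu> y \<le> ennreal (1 + b * (B + D * R))"
proof -
  have "laplace_conv b \<mu> y
      \<le> laplace_conv b lborel_pos y
        + ennreal b * (\<integral>\<^sup>+u. ennreal B + err_conv u \<partial>laplace_measure b y)"
    by (rule laplace_conv_le_of_emeasure_approx[OF left_finite_measure_axioms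
          left_finite_measure_lborel_pos assms(1) _ emeasure_mu_le_err_conv
          emeasure_lborel_pos_le_err_conv]) measurable
  also have "\<dots> \<le> 1 + ennreal b * ennreal (B + D * R)"
    by (intro add_mono mult_left_mono laplace_conv_lborel_pos_le_1 nn_integral_err_conv_le assms)
      auto
  also have "\<dots> = ennreal (1 + b * (B + D * R))"
    using assms(1,2) B_nonneg D_nonneg by (simp add: ennreal_mult)
  finally show ?thesis .
qed

lemma half_le_laplace_conv_mu_add:
  assumes "b > 0" "R \<ge> 0" "\<And>y'. laplace_conv b \<mu> y' \<le> ennreal R" and "y \<ge> 0"
  shows "ennreal (1 / 2) \<le> laplace_conv b \<mu> y + ennreal (b * (B + D * R))"
proof -
  have "ennreal (1 / 2) \<le> laplace_conv b lborel_pos y"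
    by (rule laplace_conv_lborel_pos_ge_half[OF assms(1,4)])
  also have "\<dots> \<le> laplace_conv b \<mu> y
      + ennreal b * (\<integral>\<^sup>+u. ennreal B + err_conv u \<partial>laplace_measure b y)"
    by (rule laplace_conv_le_of_emeasure_approx[OF left_finite_measure_lborel_pos
          left_finite_measure_axioms assms(1) _ emeasure_lborel_pos_le_err_conv
          emeasure_mu_le_err_conv]) measurable
  also have "\<dots> \<le> laplace_conv b \<mu> y + ennreal b * ennreal (B + D * R)"
    by (intro add_left_mono mult_left_mono nn_integral_err_conv_le assms) auto
  finally show ?thesis
    using assms(1,2) B_nonneg D_nonneg by (simp add: ennreal_mult)
qed

text \<open>As \<open>err\<close> lives on the positive half-line, it suffices to absorb the error into the supremum
  over \<open>{..Y}\<close>, which is finite a priori; the resulting bound does not depend on \<open>Y\<close>.\<close>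

lemma laplace_conv_mu_le_2:
  assumes "b > 0" "8 * b * (B + D) \<le> 1"
  shows "laplace_conv b \<mu> Y \<le> 2"
proof -
  define S where "S = (SUP y\<in>{..Y}. laplace_conv b \<mu> y)"
  have "ennreal m * S = (SUP y\<in>{..Y}. ennreal m * laplace_conv b \<mu> y)"
    unfolding S_def by (rule SUP_mult_left_ennreal)
  also have "\<dots> \<le> ennreal (1 + b * (max 0 Y + B))"
    using assms
    by (intro SUP_least order_trans[OF laplace_conv_mu_growth] ennreal_leI add_left_mono
        mult_left_mono) auto
  also have "\<dots> < \<infinity>"
    by simp
  finally have "S < \<infinity>"
    using m_pos by (auto simp: ennreal_mult_less_top)
  then obtain R where R: "R \<ge> 0" "S = ennreal R"
    by (cases S) auto
  have le_R: "laplace_conv b \<mu> y \<le> ennreal R" if "y \<le> Y" for y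
    unfolding R(2)[symmetric] S_def using that by (auto intro: SUP_upper)
  then have "S \<le> ennreal (1 + b * (B + D * R))"
    unfolding S_def by (intro SUP_least laplace_conv_mu_le_add assms R) auto
  then have "R \<le> 1 + b * (B + D * R)"
    unfolding R(2) using R(1) assms B_nonneg D_nonneg by (subst (asm) ennreal_le_iff) auto
  moreover have "0 \<le> b * B" "0 \<le> b * D"
    using assms B_nonneg D_nonneg by simp_all
  then have "b * B \<le> 1 / 8" "b * D \<le> 1 / 8"
    using assms(2) by (simp_all add: algebra_simps)
  moreover from \<open>b * D \<le> 1 / 8\<close> have "b * D * R \<le> 1 / 8 * R"
    using R(1) by (rule mult_right_mono)
  ultimately have "R \<le> 2"
    by (simp add: algebra_simps)
  with le_R[of Y] show ?thesis
    by (auto intro: order_trans ennreal_leI[of R 2, simplified])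
qed

lemma laplace_conv_mu_ge_quarter:
  assumes b: "b > 0" "8 * b * (B + D) \<le> 1" and "y \<ge> 0"
  shows "ennreal (1 / 4) \<le> laplace_conv b \<mu> y"
proof -
  have "b * (B + D * 2) \<le> b * (2 * (B + D))"
    using b B_nonneg by (intro mult_left_mono) auto
  also have "\<dots> \<le> 1 / 4"
    using b by (simp add: algebra_simps)
  finally have error: "ennreal (b * (B + D * 2)) \<le> ennreal (1 / 4)"
    by (rule ennreal_leI)
  have "ennreal (1 / 4) + ennreal (1 / 4) = ennreal (1 / 2)"
    by (subst ennreal_plus[symmetric]) simp_all
  also have "\<dots> \<le> laplace_conv b \<mu> y + ennreal (b * (B + D * 2))"
    using assms laplace_conv_mu_le_2[OF b] by (intro half_le_laplace_conv_mu_add) auto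
  also have "\<dots> \<le> ennreal (1 / 4) + laplace_conv b \<mu> y"
    using error by (subst add.commute) (rule add_right_mono)
  finally show ?thesis
    by (simp only: ennreal_add_left_cancel_le) simp
qed

lemma exp_conv_mu_le:
  assumes "0 < b" "b \<le> 1" "8 * b * (B + D) \<le> 1"
  shows "exp_conv \<mu> t \<le> ennreal (4 / b)"
proof -
  have "exp_conv \<mu> t \<le> ennreal (2 / b) * laplace_conv b \<mu> t"
    by (rule exp_conv_le_laplace_conv[OF sets_mu assms(1,2)])
  also have "\<dots> \<le> ennreal (2 / b) * ennreal 2"
    using laplace_conv_mu_le_2[OF assms(1,3)] by (intro mult_left_mono) auto
  also have "\<dots> = ennreal (4 / b)"
    using assms(1) by (simp flip: ennreal_mult ennreal_numeral)
  finally show ?thesis .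
qed

lemma exp_conv_mu_ge:
  assumes b: "b > 0" "8 * b * (B + D) \<le> 1" and V: "b / 2 * V = ln 32" and "t \<ge> V"
  shows "ennreal (exp (- (2 * V)) / (4 * b)) \<le> exp_conv \<mu> t"
proof (cases "exp_conv \<mu> t")
  case (real s)
  have "8 * (b / 2) * (B + D) \<le> 1"
    using b B_nonneg D_nonneg by simp
  then have laplace_conv_half_le: "laplace_conv (b / 2) \<mu> y \<le> 2" for y
    using b(1) by (intro laplace_conv_mu_le_2) auto
  \<comment> \<open>The constant 32 makes the tail at most \<open>1 / 8\<close>, half of the lower bound for the convolution.\<close>
  have tail: "exp (- (b / 2 * V)) = 1 / 32"
    unfolding V by (simp add: exp_minus)
  have "ennreal (1 / 4) \<le> laplace_conv b \<mu> (t - V)"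
    using b \<open>t \<ge> V\<close> by (intro laplace_conv_mu_ge_quarter) auto
  also have "\<dots> \<le> ennreal (b / 2 * exp (2 * V)) * exp_conv \<mu> (t - V + V)
      + ennreal (2 * exp (- (b / 2 * V))) * laplace_conv (b / 2) \<mu> (t - V)"
    by (rule laplace_conv_le_exp_conv[OF sets_mu b(1)])
  also have "\<dots> \<le> ennreal (b / 2 * exp (2 * V)) * ennreal s + ennreal (2 * (1 / 32)) * ennreal 2"
    unfolding tail using real laplace_conv_half_le by (intro add_mono mult_left_mono) auto
  also have "\<dots> = ennreal (b / 2 * exp (2 * V) * s + 1 / 8)"
    using real b(1) by (simp add: ennreal_plus flip: ennreal_mult ennreal_numeral)
  finally have "1 / 4 \<le> b / 2 * exp (2 * V) * s + 1 / 8"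
    using real b(1) by (subst (asm) ennreal_le_iff) auto
  then have "exp (- (2 * V)) / (4 * b) \<le> s"
    using b(1) by (simp add: exp_minus field_simps)
  then show ?thesis
    using real by (simp add: ennreal_leI)
qed simp

theorem exp_conv_mu_bounds:
  "\<exists>c>0. \<exists>C T. \<forall>t\<ge>T. ennreal c \<le> exp_conv \<mu> t \<and> exp_conv \<mu> t \<le> ennreal C"
proof -
  define b where "b = 1 / (8 * (B + D) + 1)"
  have b: "0 < b" "b \<le> 1" and small: "8 * b * (B + D) \<le> 1"
    using B_nonneg D_nonneg by (simp_all add: b_def add_nonneg_pos pos_divide_le_eq)
  define V where "V = 2 / b * ln 32"
  have "b / 2 * V = ln 32"
    using b by (simp add: V_def)
  then have "\<forall>t\<ge>V. ennreal (exp (- (2 * V)) / (4 * b)) \<le> exp_conv \<mu> t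
      \<and> exp_conv \<mu> t \<le> ennreal (4 / b)"
    using exp_conv_mu_ge[OF b(1) small] exp_conv_mu_le[OF b small] by blast
  moreover have "exp (- (2 * V)) / (4 * b) > 0"
    using b by simp
  ultimately show ?thesis
    by blast
qed

end

section \<open>Generalized integers and prime powers\<close>

definition gen_ints :: "(nat \<Rightarrow> real) \<Rightarrow> real \<Rightarrow> (nat \<Rightarrow> nat) set" where
  "gen_ints p x = {\<alpha>. finite {k. \<alpha> k \<noteq> 0} \<and> gen_int p \<alpha> < x}"

definition prime_powers :: "(nat \<Rightarrow> real) \<Rightarrow> real \<Rightarrow> (nat \<times> nat) set" where
  "prime_powers p x = {(k, j). j \<ge> 1 \<and> p k ^ j < x}"

lemma beurling_N_eq_card: "beurling_N p x = real (card (gen_ints p x))"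
  by (simp add: beurling_N_def gen_ints_def)

lemma beurling_N_nonneg: "beurling_N p x \<ge> 0"
  by (simp add: beurling_N_eq_card)

lemma finite_support_fun_upd:
  "finite {i. (\<alpha>(k := v)) i \<noteq> 0} \<longleftrightarrow> finite {i. \<alpha> i \<noteq> (0::'a::zero)}"
proof -
  have "{i. (\<alpha>(k := v)) i \<noteq> 0} - {k} = {i. \<alpha> i \<noteq> 0} - {k}"
    by auto
  then show ?thesis
    by (metis finite_Diff_insert Diff_empty finite_Diff)
qed

lemma gen_int_eq_prod:
  assumes "finite K" "{k. \<alpha> k \<noteq> 0} \<subseteq> K"
  shows "gen_int p \<alpha> = (\<Prod>k\<in>K. p k ^ \<alpha> k)"
  unfolding gen_int_def by (rule prod.mono_neutral_left) (use assms in auto)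

lemma gen_int_fun_upd_add:
  assumes "finite {k. \<alpha> k \<noteq> 0}"
  shows "gen_int p (\<alpha>(k := \<alpha> k + j)) = gen_int p \<alpha> * p k ^ j"
proof -
  let ?K = "insert k {k. \<alpha> k \<noteq> 0}"
  have "gen_int p (\<alpha>(k := \<alpha> k + j)) = (\<Prod>i\<in>?K. p i ^ (\<alpha>(k := \<alpha> k + j)) i)"
    by (rule gen_int_eq_prod) (use assms in auto)
  also have "\<dots> = p k ^ (\<alpha> k + j) * (\<Prod>i\<in>?K - {k}. p i ^ \<alpha> i)"
    using assms by (subst prod.remove[of _ k]) (auto intro!: prod.cong)
  also have "\<dots> = p k ^ j * (\<Prod>i\<in>?K. p i ^ \<alpha> i)"
    using assms by (subst (2) prod.remove[of _ k]) (auto simp: power_add)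
  also have "(\<Prod>i\<in>?K. p i ^ \<alpha> i) = gen_int p \<alpha>"
    by (rule gen_int_eq_prod[symmetric]) (use assms in auto)
  finally show ?thesis
    by (simp only: mult.commute)
qed

locale beurling =
  fixes p :: "nat \<Rightarrow> real"
  assumes primes: "beurling_primes p"
begin

abbreviation "N \<equiv> beurling_N p"
abbreviation "\<psi> \<equiv> beurling_psi p"

lemma p_mono: "i \<le> k \<Longrightarrow> p i \<le> p k"
  using primes by (simp add: beurling_primes_def monoD)

lemma p_gt_1: "p k > 1"
  using primes p_mono[of 0 k] by (simp add: beurling_primes_def)

lemma p_pos: "p k > 0"
  using p_gt_1[of k] by linarith

lemma ln_p_pos: "ln (p k) > 0"
  using p_gt_1[of k] by simp

lemma psi_nonneg: "\<psi> x \<ge> 0"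
  unfolding beurling_psi_def using ln_p_pos by (intro sum_nonneg) (auto simp: less_imp_le)

lemma finite_primes_less: "finite {k. p k < x}"
proof -
  have "\<forall>\<^sub>F k in sequentially. x \<le> p k"
    using primes by (auto simp: beurling_primes_def filterlim_at_top)
  then obtain K where "\<And>k. k \<ge> K \<Longrightarrow> x \<le> p k"
    by (auto simp: eventually_sequentially)
  then have "{k. p k < x} \<subseteq> {..<K}"
    by (auto simp: not_less[symmetric])
  then show ?thesis
    by (rule finite_subset) simp
qed

lemma finite_prime_powers: "finite (prime_powers p x)"
proof -
  obtain M where M: "x < p 0 ^ M"
    using real_arch_pow[OF p_gt_1] by blast
  have "prime_powers p x \<subseteq> {k. p k < x} \<times> {..<M}"
  proof (rule subrelI)
    fix k j assume "(k, j) \<in> prime_powers p x"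
    then have j: "j \<ge> 1" "p k ^ j < x"
      by (simp_all add: prime_powers_def)
    have "p k \<le> p k ^ j"
      using j(1) p_gt_1[of k] by (intro self_le_power) auto
    moreover have "p 0 ^ j \<le> p k ^ j"
      using p_pos[of 0] by (intro power_mono p_mono) auto
    then have "p 0 ^ j < p 0 ^ M"
      using j(2) M by linarith
    then have "j < M"
      using p_gt_1[of 0] by simp
    ultimately show "(k, j) \<in> {k. p k < x} \<times> {..<M}"
      using j(2) by simp
  qed
  then show ?thesis
    by (rule finite_subset) (simp add: finite_primes_less)
qed

lemma gen_int_ge_1: "gen_int p \<alpha> \<ge> 1"
  unfolding gen_int_def by (intro prod_ge_1 one_le_power less_imp_le p_gt_1)

lemma gen_int_pos: "gen_int p \<alpha> > 0"
  using gen_int_ge_1[of \<alpha>] by linarith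

lemma power_le_gen_int:
  assumes "finite {k. \<alpha> k \<noteq> 0}"
  shows "p k ^ \<alpha> k \<le> gen_int p \<alpha>"
proof -
  have "finite {i. (\<alpha>(k := 0)) i \<noteq> 0}"
    using assms by (simp only: finite_support_fun_upd)
  from gen_int_fun_upd_add[OF this, of p k "\<alpha> k"]
  have "gen_int p \<alpha> = gen_int p (\<alpha>(k := 0)) * p k ^ \<alpha> k"
    by (simp only: fun_upd_same fun_upd_upd add_0 fun_upd_triv)
  moreover have "1 * p k ^ \<alpha> k \<le> gen_int p (\<alpha>(k := 0)) * p k ^ \<alpha> k"
    using p_pos[of k] by (intro mult_right_mono gen_int_ge_1) simp
  ultimately show ?thesis
    by simp
qed

lemma finite_gen_ints: "finite (gen_ints p x)"
proof -
  define graph where "graph \<alpha> = {(k, j). j \<ge> 1 \<and> \<alpha> k = j}" for \<alpha> :: "nat \<Rightarrow> nat"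
  have "inj graph"
  proof (intro injI ext)
    fix \<alpha> \<beta> k assume "graph \<alpha> = graph \<beta>"
    then have "(k, j) \<in> graph \<alpha> \<longleftrightarrow> (k, j) \<in> graph \<beta>" for j
      by simp
    from this[of "\<alpha> k"] this[of "\<beta> k"] show "\<alpha> k = \<beta> k"
      by (auto simp: graph_def)
  qed
  moreover have "graph ` gen_ints p x \<subseteq> Pow (prime_powers p x)"
  proof (intro image_subsetI PowI subrelI)
    fix \<alpha> k j assume "\<alpha> \<in> gen_ints p x" "(k, j) \<in> graph \<alpha>"
    then show "(k, j) \<in> prime_powers p x"
      using power_le_gen_int[of \<alpha> k] by (auto simp: graph_def gen_ints_def prime_powers_def)
  qed
  ultimately show ?thesis
    by (rule inj_on_finite[OF inj_on_subset[OF _ subset_UNIV]]) (simp add: finite_prime_powers)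
qed

lemma N_mono: "x \<le> y \<Longrightarrow> N x \<le> N y"
  unfolding beurling_N_eq_card
  by (intro of_nat_mono card_mono finite_gen_ints) (auto simp: gen_ints_def)

lemma N_measurable [measurable]: "N \<in> borel_measurable borel"
  by (intro borel_measurable_mono monoI N_mono)

lemma gen_ints_empty: "x \<le> 1 \<Longrightarrow> gen_ints p x = {}"
  by (auto simp: gen_ints_def not_less intro: order_trans[OF _ gen_int_ge_1])

lemma N_eq_0: "x \<le> 1 \<Longrightarrow> N x = 0"
  by (simp add: beurling_N_eq_card gen_ints_empty)

lemma N_ge_1:
  assumes "x > 1"
  shows "N x \<ge> 1"
proof -
  have "(\<lambda>_. 0) \<in> gen_ints p x"
    using assms by (simp add: gen_ints_def gen_int_def)
  then have "card (gen_ints p x) > 0"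
    using finite_gen_ints by (auto simp: card_gt_0_iff)
  then show ?thesis
    by (simp add: beurling_N_eq_card)
qed

lemma fun_upd_add_in_gen_ints_iff:
  "\<alpha>(k := \<alpha> k + j) \<in> gen_ints p x \<longleftrightarrow> \<alpha> \<in> gen_ints p (x / p k ^ j)"
  using p_pos[of k]
  by (auto simp: gen_ints_def finite_support_fun_upd gen_int_fun_upd_add pos_less_divide_eq
      simp del: fun_upd_apply neq0_conv)

lemma card_gen_ints_divisible:
  "card {\<alpha> \<in> gen_ints p x. j \<le> \<alpha> k} = card (gen_ints p (x / p k ^ j))"
proof -
  let ?mult = "\<lambda>\<alpha>. \<alpha>(k := \<alpha> k + j)"
  have "{\<alpha> \<in> gen_ints p x. j \<le> \<alpha> k} = ?mult ` gen_ints p (x / p k ^ j)"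
  proof (intro equalityI subsetI)
    fix \<alpha> assume \<alpha>: "\<alpha> \<in> {\<alpha> \<in> gen_ints p x. j \<le> \<alpha> k}"
    then have eq: "\<alpha> = ?mult (\<alpha>(k := \<alpha> k - j))"
      by auto
    with \<alpha> have "\<alpha>(k := \<alpha> k - j) \<in> gen_ints p (x / p k ^ j)"
      using fun_upd_add_in_gen_ints_iff[of "\<alpha>(k := \<alpha> k - j)" k j x] by auto
    with eq show "\<alpha> \<in> ?mult ` gen_ints p (x / p k ^ j)"
      by (rule image_eqI)
  next
    fix \<alpha> assume "\<alpha> \<in> ?mult ` gen_ints p (x / p k ^ j)"
    then show "\<alpha> \<in> {\<alpha> \<in> gen_ints p x. j \<le> \<alpha> k}"
      using fun_upd_add_in_gen_ints_iff by auto
  qed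
  moreover have "inj_on ?mult A" for A
  proof (intro inj_onI ext)
    fix \<alpha> \<beta> i assume "?mult \<alpha> = ?mult \<beta>"
    from fun_cong[OF this, of i] show "\<alpha> i = \<beta> i"
      by (simp split: if_splits)
  qed
  ultimately show ?thesis
    by (simp only: card_image)
qed

definition log_sum :: "real \<Rightarrow> real" where
  "log_sum x = (\<Sum>\<alpha>\<in>gen_ints p x. ln (gen_int p \<alpha>))"

lemma log_sum_nonneg: "log_sum x \<ge> 0"
  unfolding log_sum_def by (intro sum_nonneg ln_ge_zero gen_int_ge_1)

lemma ln_gen_int:
  assumes "\<alpha> \<in> gen_ints p x"
  shows "ln (gen_int p \<alpha>) = (\<Sum>(k, j)\<in>prime_powers p x. if j \<le> \<alpha> k then ln (p k) else 0)"
proof -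
  let ?A = "{k. \<alpha> k \<noteq> 0}"
  have fin: "finite ?A" and less: "gen_int p \<alpha> < x"
    using assms by (auto simp: gen_ints_def)
  have "p k ^ j < x" if "j \<le> \<alpha> k" for k j
  proof -
    have "p k ^ j \<le> p k ^ \<alpha> k"
      using that p_gt_1[of k] by (intro power_increasing) auto
    then show ?thesis
      using power_le_gen_int[OF fin, of k] less by linarith
  qed
  then have divisors: "(SIGMA k:?A. {1..\<alpha> k}) = {i \<in> prime_powers p x. snd i \<le> \<alpha> (fst i)}"
    by (auto simp: prime_powers_def)
  have "ln (gen_int p \<alpha>) = (\<Sum>k\<in>?A. ln (p k ^ \<alpha> k))"
    unfolding gen_int_def using fin p_pos by (intro ln_prod) (auto simp: less_imp_neq[symmetric])
  also have "\<dots> = (\<Sum>k\<in>?A. \<Sum>j\<in>{1..\<alpha> k}. ln (p k))"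
    using p_pos by (intro sum.cong refl) (simp add: ln_realpow)
  also have "\<dots> = (\<Sum>(k, j)\<in>(SIGMA k:?A. {1..\<alpha> k}). ln (p k))"
    using fin by (subst sum.Sigma) auto
  also have "\<dots> = (\<Sum>(k, j)\<in>prime_powers p x. if j \<le> \<alpha> k then ln (p k) else 0)"
    unfolding divisors
    by (subst sum.inter_filter[OF finite_prime_powers]) (auto intro!: sum.cong)
  finally show ?thesis .
qed

text \<open>The identity \<open>log \<cdot> dN = dN * d\<psi>\<close>.\<close>

lemma log_sum_eq_sum_prime_powers:
  "log_sum x = (\<Sum>(k, j)\<in>prime_powers p x. ln (p k) * N (x / p k ^ j))"
proof -
  let ?l = "\<lambda>\<alpha> i. if snd i \<le> \<alpha> (fst i) then ln (p (fst i)) else 0"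
  have "log_sum x = (\<Sum>\<alpha>\<in>gen_ints p x. \<Sum>i\<in>prime_powers p x. ?l \<alpha> i)"
    unfolding log_sum_def by (intro sum.cong refl) (simp add: ln_gen_int case_prod_unfold)
  also have "\<dots> = (\<Sum>i\<in>prime_powers p x. \<Sum>\<alpha>\<in>gen_ints p x. ?l \<alpha> i)"
    by (rule sum.swap)
  also have "\<dots> = (\<Sum>i\<in>prime_powers p x. ln (p (fst i)) * N (x / p (fst i) ^ snd i))"
    by (intro sum.cong refl) (simp add: beurling_N_eq_card card_gen_ints_divisible
        flip: sum.inter_filter[OF finite_gen_ints])
  finally show ?thesis
    by (simp add: case_prod_unfold)
qed

lemma gen_int_less_iff_less_ln_quotient:
  assumes "x > 0"
  shows "gen_int p \<alpha> < x * exp (- s) \<longleftrightarrow> s < ln (x / gen_int p \<alpha>)"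
proof -
  have "s < ln (x / gen_int p \<alpha>) \<longleftrightarrow> exp s < x / gen_int p \<alpha>"
    using assms gen_int_pos[of \<alpha>] by (subst exp_less_cancel_iff[symmetric]) simp
  then show ?thesis
    using gen_int_pos[of \<alpha>] by (simp add: exp_minus field_simps)
qed

lemma N_mult_exp_minus_eq_sum:
  assumes "x > 0" "s \<ge> 0"
  shows "N (x * exp (- s)) = (\<Sum>\<alpha>\<in>gen_ints p x. indicator {..<ln (x / gen_int p \<alpha>)} s)"
proof -
  have "x * exp (- s) \<le> x * 1"
    using assms by (intro mult_left_mono) auto
  then have "gen_ints p (x * exp (- s)) = {\<alpha> \<in> gen_ints p x. s < ln (x / gen_int p \<alpha>)}"
    by (auto simp: gen_ints_def gen_int_less_iff_less_ln_quotient[OF assms(1), symmetric])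
  then have "N (x * exp (- s)) = (\<Sum>\<alpha>\<in>gen_ints p x. if s < ln (x / gen_int p \<alpha>) then 1 else 0)"
    by (simp add: beurling_N_eq_card flip: sum.inter_filter[OF finite_gen_ints])
  then show ?thesis
    by (simp add: indicator_def of_bool_def)
qed

lemma sum_ln_quotient_eq_nn_integral:
  assumes "x > 0"
  shows "ennreal (\<Sum>\<alpha>\<in>gen_ints p x. ln (x / gen_int p \<alpha>))
      = (\<integral>\<^sup>+s\<in>{0<..}. ennreal (N (x * exp (- s))) \<partial>lborel)"
proof -
  let ?l = "\<lambda>\<alpha>. ln (x / gen_int p \<alpha>)"
  have l_nonneg: "?l \<alpha> \<ge> 0" if "\<alpha> \<in> gen_ints p x" for \<alpha>
    using that gen_int_pos[of \<alpha>] by (intro ln_ge_zero) (simp add: gen_ints_def)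
  have "(\<integral>\<^sup>+s\<in>{0<..}. ennreal (N (x * exp (- s))) \<partial>lborel)
      = (\<integral>\<^sup>+s. ennreal (\<Sum>\<alpha>\<in>gen_ints p x. indicator {0<..<?l \<alpha>} s) \<partial>lborel)"
    by (intro nn_integral_cong)
      (auto simp: N_mult_exp_minus_eq_sum[OF assms] split: split_indicator
        intro!: arg_cong[where f=ennreal] sum.cong)
  also have "\<dots> = (\<integral>\<^sup>+s. (\<Sum>\<alpha>\<in>gen_ints p x. indicator {0<..<?l \<alpha>} s) \<partial>lborel)"
    by (simp add: ennreal_indicator flip: sum_ennreal)
  also have "\<dots> = (\<Sum>\<alpha>\<in>gen_ints p x. emeasure lborel {0<..<?l \<alpha>})"
    by (subst nn_integral_sum) simp_all
  also have "\<dots> = (\<Sum>\<alpha>\<in>gen_ints p x. ennreal (?l \<alpha>))"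
    by (intro sum.cong refl) (simp add: l_nonneg)
  also have "\<dots> = ennreal (\<Sum>\<alpha>\<in>gen_ints p x. ?l \<alpha>)"
    by (intro sum_ennreal l_nonneg)
  finally show ?thesis ..
qed

lemma sum_ln_quotient_le:
  assumes C: "C \<ge> 0" "\<And>x. x > 0 \<Longrightarrow> N x \<le> C * x" and "x > 0"
  shows "(\<Sum>\<alpha>\<in>gen_ints p x. ln (x / gen_int p \<alpha>)) \<le> C * x"
proof -
  have "ennreal (\<Sum>\<alpha>\<in>gen_ints p x. ln (x / gen_int p \<alpha>))
      \<le> (\<integral>\<^sup>+s\<in>{0..}. ennreal (C * x * exp (- s)) \<partial>lborel)"
    unfolding sum_ln_quotient_eq_nn_integral[OF \<open>x > 0\<close>]
    using C(2) \<open>x > 0\<close>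
    by (intro nn_integral_mono) (auto intro!: ennreal_leI simp: mult.assoc split: split_indicator)
  also have "\<dots> = ennreal (0 - (- (C * x * exp (- 0))))"
  proof (rule nn_integral_FTC_atLeast)
    have "((\<lambda>s::real. exp (- s)) \<longlongrightarrow> 0) at_top"
      by (rule filterlim_compose[OF exp_at_bot filterlim_uminus_at_bot_at_top])
    then show "((\<lambda>s. - (C * x * exp (- s))) \<longlongrightarrow> 0) at_top"
      using tendsto_mult_left[of _ 0 _ "- (C * x)"] by fastforce
  qed (use C(1) \<open>x > 0\<close> in \<open>auto intro!: derivative_eq_intros\<close>)
  finally show ?thesis
    using C(1) \<open>x > 0\<close> by (simp add: ennreal_le_iff)
qed

lemma log_sum_bounds:
  assumes C: "C \<ge> 0" "\<And>x. x > 0 \<Longrightarrow> N x \<le> C * x" and "x > 0"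
  shows "N x * ln x - C * x \<le> log_sum x" and "log_sum x \<le> N x * ln x"
proof -
  define D where "D = (\<Sum>\<alpha>\<in>gen_ints p x. ln (x / gen_int p \<alpha>))"
  have "D = (\<Sum>\<alpha>\<in>gen_ints p x. ln x - ln (gen_int p \<alpha>))"
    unfolding D_def using \<open>x > 0\<close> gen_int_pos
    by (intro sum.cong refl) (simp add: ln_div less_imp_neq[symmetric])
  then have "log_sum x = N x * ln x - D"
    by (simp add: log_sum_def sum_subtractf beurling_N_eq_card)
  moreover have "D \<ge> 0"
    unfolding D_def using gen_int_pos by (intro sum_nonneg ln_ge_zero) (simp add: gen_ints_def)
  moreover have "D \<le> C * x"
    unfolding D_def by (rule sum_ln_quotient_le[OF assms])
  ultimately show "N x * ln x - C * x \<le> log_sum x" "log_sum x \<le> N x * ln x"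
    by linarith+
qed

section \<open>The renewal measure of a Beurling system\<close>

definition prime_power_measure :: "real measure" where
  "prime_power_measure =
    distr (density (count_space {(k, j). j \<ge> 1}) (\<lambda>(k, j). ennreal (ln (p k) / p k ^ j)))
      borel (\<lambda>(k, j). ln (p k ^ j))"

lemma sets_prime_power_measure [simp, measurable_cong]: "sets prime_power_measure = sets borel"
  by (simp add: prime_power_measure_def)

lemma nn_integral_prime_power_measure:
  fixes f :: "real \<Rightarrow> real"
  assumes [measurable]: "f \<in> borel_measurable borel"
    and nonneg: "\<And>v. f v \<ge> 0" and zero: "\<And>v. v \<ge> u \<Longrightarrow> f v = 0"
  shows "(\<integral>\<^sup>+v. ennreal (f v) \<partial>prime_power_measure)
      = ennreal (\<Sum>(k, j)\<in>prime_powers p (exp u). ln (p k) / p k ^ j * f (ln (p k ^ j)))"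
proof -
  let ?g = "\<lambda>(k, j). ln (p k) / p k ^ j * f (ln (p k ^ j))"
  have weight_nonneg: "ln (p k) / p k ^ j \<ge> 0" for k j
    using ln_p_pos[of k] p_pos[of k] by simp
  have "(\<integral>\<^sup>+v. ennreal (f v) \<partial>prime_power_measure)
      = (\<integral>\<^sup>+i. ennreal (?g i) \<partial>count_space {(k, j). j \<ge> 1})"
    unfolding prime_power_measure_def
    by (simp add: nn_integral_distr nn_integral_density case_prod_unfold nonneg
        flip: ennreal_mult'')
  also have "\<dots> = (\<Sum>i\<in>prime_powers p (exp u). ennreal (?g i))"
  proof (rule nn_integral_count_space'[OF finite_prime_powers])
    show "ennreal (?g i) = 0" if i: "i \<in> {(k, j). j \<ge> 1}" "i \<notin> prime_powers p (exp u)" for i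
    proof -
      obtain k j where "i = (k, j)" "exp u \<le> p k ^ j"
        using i by (cases i) (auto simp: prime_powers_def not_less)
      moreover from this have "u \<le> ln (p k ^ j)"
        using p_pos[of k] by (subst ln_ge_iff) simp_all
      ultimately show ?thesis
        using zero by simp
    qed
  qed (auto simp: prime_powers_def)
  also have "\<dots> = ennreal (\<Sum>i\<in>prime_powers p (exp u). ?g i)"
    using mult_nonneg_nonneg[OF weight_nonneg nonneg]
    by (intro sum_ennreal) (simp add: case_prod_unfold)
  finally show ?thesis .
qed

lemma exp_conv_prime_power_measure: "exp_conv prime_power_measure t = ennreal (\<psi> (exp t) / exp t)"
proof -
  let ?f = "\<lambda>v. exp (v - t) * indicator {..<t} v"
  have "exp_conv prime_power_measure t = (\<integral>\<^sup>+v. ennreal (?f v) \<partial>prime_power_measure)"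
    unfolding exp_conv_def by (intro nn_integral_cong) (simp split: split_indicator)
  also have "\<dots> = ennreal (\<Sum>(k, j)\<in>prime_powers p (exp t). ln (p k) / p k ^ j * ?f (ln (p k ^ j)))"
    by (rule nn_integral_prime_power_measure) auto
  also have "(\<Sum>(k, j)\<in>prime_powers p (exp t). ln (p k) / p k ^ j * ?f (ln (p k ^ j)))
      = (\<Sum>(k, j)\<in>prime_powers p (exp t). ln (p k) / exp t)"
  proof (intro sum.cong refl, clarify)
    fix k j assume "(k, j) \<in> prime_powers p (exp t)"
    then have "ln (p k ^ j) < ln (exp t)"
      using p_pos[of k] by (subst ln_less_cancel_iff) (simp_all add: prime_powers_def)
    then show "ln (p k) / p k ^ j * ?f (ln (p k ^ j)) = ln (p k) / exp t"
      using p_pos[of k] by (simp add: exp_diff del: ln_realpow)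
  qed
  also have "\<dots> = \<psi> (exp t) / exp t"
    by (simp add: beurling_psi_def prime_powers_def sum_divide_distrib case_prod_unfold)
  finally show ?thesis .
qed

definition N_ratio :: "real \<Rightarrow> real" where
  "N_ratio z = N (exp z) / exp z"

lemma N_ratio_measurable [measurable]: "N_ratio \<in> borel_measurable borel"
  unfolding N_ratio_def by measurable

lemma N_ratio_nonneg: "N_ratio z \<ge> 0"
  by (simp add: N_ratio_def beurling_N_nonneg)

lemma N_ratio_nonpos: "z \<le> 0 \<Longrightarrow> N_ratio z = 0"
  by (simp add: N_ratio_def N_eq_0)

lemma N_ratio_le_N:
  assumes "0 \<le> z" "z \<le> Z"
  shows "N_ratio z \<le> N (exp Z)"
proof -
  have "N_ratio z \<le> N (exp z) / 1"
    unfolding N_ratio_def using assms(1) by (intro divide_left_mono beurling_N_nonneg) auto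
  also have "\<dots> \<le> N (exp Z)"
    using assms(2) by (simp add: N_mono)
  finally show ?thesis .
qed

lemma nn_integral_N_ratio_prime_power_measure:
  "(\<integral>\<^sup>+v. ennreal (N_ratio (u - v)) \<partial>prime_power_measure) = ennreal (log_sum (exp u) / exp u)"
proof -
  have "(\<integral>\<^sup>+v. ennreal (N_ratio (u - v)) \<partial>prime_power_measure)
      = ennreal (\<Sum>(k, j)\<in>prime_powers p (exp u). ln (p k) / p k ^ j * N_ratio (u - ln (p k ^ j)))"
    by (rule nn_integral_prime_power_measure) (simp_all add: N_ratio_nonneg N_ratio_nonpos)
  also have "(\<Sum>(k, j)\<in>prime_powers p (exp u). ln (p k) / p k ^ j * N_ratio (u - ln (p k ^ j)))
      = (\<Sum>(k, j)\<in>prime_powers p (exp u). ln (p k) * N (exp u / p k ^ j) / exp u)"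
  proof (intro sum.cong refl, clarify)
    fix k j
    show "ln (p k) / p k ^ j * N_ratio (u - ln (p k ^ j)) = ln (p k) * N (exp u / p k ^ j) / exp u"
      using p_pos[of k] by (simp add: N_ratio_def exp_diff del: ln_realpow)
  qed
  also have "\<dots> = log_sum (exp u) / exp u"
    by (simp add: log_sum_eq_sum_prime_powers sum_divide_distrib case_prod_unfold)
  finally show ?thesis .
qed

end

lemma nn_integral_exp_substitution_finite:
  fixes f :: "real \<Rightarrow> real"
  assumes "f integrable_on {1..}" and nonneg: "\<And>x. x \<ge> 1 \<Longrightarrow> f x \<ge> 0"
  shows "(\<integral>\<^sup>+z\<in>{0..}. ennreal (exp z * f (exp z)) \<partial>lborel) < \<infinity>"
proof -
  let ?h = "\<lambda>z. \<bar>exp z\<bar> * f (exp z)"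
  have image: "exp ` {0::real..} = {1..}"
  proof (intro equalityI subsetI)
    fix x :: real assume "x \<in> {1..}"
    then show "x \<in> exp ` {0..}"
      by (intro image_eqI[of _ _ "ln x"]) auto
  qed auto
  have "f absolutely_integrable_on {1..}"
    using assms by (intro nonnegative_absolutely_integrable_1) auto
  then have "f absolutely_integrable_on exp ` {0..} \<and> integral (exp ` {0..}) f = integral {1..} f"
    by (simp add: image)
  then have "?h absolutely_integrable_on {0..}"
    by (subst (asm) has_absolute_integral_change_of_variables_1'[symmetric])
      (auto intro!: derivative_eq_intros simp: inj_on_def)
  then have "(\<integral>\<^sup>+z. ennreal (norm (indicator {0..} z *\<^sub>R ?h z)) \<partial>lborel) < \<infinity>"
    by (simp add: set_integrable_def integrable_iff_bounded nn_integral_completion)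
  also have "(\<integral>\<^sup>+z. ennreal (norm (indicator {0..} z *\<^sub>R ?h z)) \<partial>lborel)
      = (\<integral>\<^sup>+z\<in>{0..}. ennreal (exp z * f (exp z)) \<partial>lborel)"
    by (intro nn_integral_cong) (simp add: nonneg split: split_indicator)
  finally show ?thesis .
qed

locale beurling_density = beurling +
  fixes a :: real
  assumes a_pos: "a > 0"
    and error_integrable: "(\<lambda>x. \<bar>(beurling_N p x - a * x) / x\<bar> / x) integrable_on {1..}"
    and error_small: "(\<lambda>x. beurling_N p x - a * x) \<in> o[at_top](\<lambda>x. x / ln x)"
begin

lemma N_ratio_approx: "\<exists>B\<ge>0. \<forall>z>0. \<bar>N_ratio z - a\<bar> * z \<le> B"
proof -
  have "\<forall>\<^sub>F x in at_top. norm (N x - a * x) \<le> 1 * norm (x / ln x)"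
    by (rule landau_o.smallD[OF error_small]) simp
  then obtain X where X: "\<And>x. x \<ge> X \<Longrightarrow> \<bar>N x - a * x\<bar> \<le> \<bar>x / ln x\<bar>"
    by (auto simp: eventually_at_top_linorder)
  define Z where "Z = max X 0"
  define B where "B = max 1 ((N (exp Z) + a) * Z)"
  have "\<bar>N_ratio z - a\<bar> * z \<le> B" if "z > 0" for z
  proof (cases "z \<ge> Z")
    case True
    then have "X \<le> exp z"
      using exp_ge_add_one_self[of z] unfolding Z_def by linarith
    then have "\<bar>N (exp z) - a * exp z\<bar> * z \<le> exp z"
      using X[of "exp z"] that by (simp add: field_simps)
    moreover have "N_ratio z - a = (N (exp z) - a * exp z) / exp z"
      by (simp add: N_ratio_def field_simps)
    ultimately show ?thesis
      by (simp add: B_def abs_divide pos_divide_le_eq le_max_iff_disj)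
  next
    case False
    then have "\<bar>N_ratio z - a\<bar> \<le> N (exp Z) + a"
      using that N_ratio_le_N[of z Z] N_ratio_nonneg[of z] a_pos by linarith
    then have "\<bar>N_ratio z - a\<bar> * z \<le> (N (exp Z) + a) * Z"
      using False that by (intro mult_mono) auto
    then show ?thesis
      by (simp add: B_def)
  qed
  then show ?thesis
    by (intro exI[of _ B]) (simp add: B_def)
qed

lemma N_ratio_lower: "\<exists>m>0. \<forall>z>0. m \<le> N_ratio z"
proof -
  obtain B where B: "B \<ge> 0" "\<And>z. z > 0 \<Longrightarrow> \<bar>N_ratio z - a\<bar> * z \<le> B"
    using N_ratio_approx by blast
  define Z where "Z = 2 * B / a"
  have "min (a / 2) (exp (- Z)) \<le> N_ratio z" if "z > 0" for z
  proof (cases "z \<le> Z")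
    case True
    have "exp (- Z) \<le> 1 / exp z"
      using True by (simp add: exp_minus field_simps)
    also have "\<dots> \<le> N_ratio z"
      unfolding N_ratio_def using that by (intro divide_right_mono N_ge_1) auto
    finally show ?thesis
      by simp
  next
    case False
    have "\<bar>N_ratio z - a\<bar> * z \<le> a / 2 * Z"
      using B(2)[OF that] a_pos by (simp add: Z_def)
    also have "\<dots> \<le> a / 2 * z"
      using False a_pos by (intro mult_left_mono) auto
    finally have "\<bar>N_ratio z - a\<bar> \<le> a / 2"
      using that by simp
    then show ?thesis
      by linarith
  qed
  then show ?thesis
    using a_pos by (intro exI[of _ "min (a / 2) (exp (- Z))"]) auto
qed

lemma N_ratio_upper: "\<exists>C\<ge>0. \<forall>z. N_ratio z \<le> C"
proof -
  obtain B where B: "B \<ge> 0" "\<And>z. z > 0 \<Longrightarrow> \<bar>N_ratio z - a\<bar> * z \<le> B"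
    using N_ratio_approx by blast
  have "N_ratio z \<le> a + B + N (exp 1)" for z
  proof -
    consider "z \<le> 0" | "0 < z" "z \<le> 1" | "z \<ge> 1"
      by linarith
    then show ?thesis
    proof cases
      case 1
      then show ?thesis
        using a_pos B(1) beurling_N_nonneg[of p "exp 1"] by (simp add: N_ratio_nonpos)
    next
      case 2
      then show ?thesis
        using a_pos B(1) N_ratio_le_N[of z 1] by linarith
    next
      case 3
      then have "\<bar>N_ratio z - a\<bar> * 1 \<le> \<bar>N_ratio z - a\<bar> * z"
        by (intro mult_left_mono) auto
      also have "\<dots> \<le> B"
        using 3 by (intro B) simp
      finally have "\<bar>N_ratio z - a\<bar> \<le> B"
        by simp
      then show ?thesis
        using beurling_N_nonneg[of p "exp 1"] by linarith
    qed
  qed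
  then show ?thesis
    using a_pos B(1) beurling_N_nonneg[of p "exp 1"]
    by (intro exI[of _ "a + B + N (exp 1)"]) auto
qed

lemma N_le_linear: "\<exists>C\<ge>0. \<forall>x>0. N x \<le> C * x"
proof -
  obtain C where C: "C \<ge> 0" "\<And>z. N_ratio z \<le> C"
    using N_ratio_upper by blast
  have "N x \<le> C * x" if "x > 0" for x
    using C(2)[of "ln x"] that by (simp add: N_ratio_def pos_divide_le_eq)
  with C(1) show ?thesis
    by blast
qed

lemma log_sum_approx: "\<exists>B\<ge>0. \<forall>u. \<bar>log_sum (exp u) / (a * exp u) - max 0 u\<bar> \<le> B"
proof -
  obtain B where B: "B \<ge> 0" "\<And>z. z > 0 \<Longrightarrow> \<bar>N_ratio z - a\<bar> * z \<le> B"
    using N_ratio_approx by blast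
  obtain C where C: "C \<ge> 0" "\<And>x. x > 0 \<Longrightarrow> N x \<le> C * x"
    using N_le_linear by blast
  have "\<bar>log_sum (exp u) / (a * exp u) - max 0 u\<bar> \<le> (B + C) / a" for u
  proof (cases "u > 0")
    case True
    have "(N (exp u) * u - C * exp u) / exp u \<le> log_sum (exp u) / exp u"
      "log_sum (exp u) / exp u \<le> N (exp u) * u / exp u"
      using log_sum_bounds[OF C, of "exp u"] by (auto intro: divide_right_mono)
    then have "\<bar>log_sum (exp u) / exp u - N_ratio u * u\<bar> \<le> C"
      using C(1) by (simp add: N_ratio_def diff_divide_distrib)
    moreover have "\<bar>N_ratio u * u - a * u\<bar> \<le> B"
      using B(2)[OF True] True by (simp add: abs_mult flip: left_diff_distrib)
    ultimately have "\<bar>log_sum (exp u) / exp u - a * u\<bar> / a \<le> (B + C) / a"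
      using a_pos by (intro divide_right_mono) auto
    also have "\<bar>log_sum (exp u) / exp u - a * u\<bar> / a = \<bar>(log_sum (exp u) / exp u - a * u) / a\<bar>"
      using a_pos by (simp add: abs_divide)
    also have "(log_sum (exp u) / exp u - a * u) / a = log_sum (exp u) / (a * exp u) - max 0 u"
      using True a_pos by (simp add: field_simps)
    finally show ?thesis .
  next
    case False
    then show ?thesis
      using B(1) C(1) a_pos by (simp add: log_sum_def gen_ints_empty)
  qed
  then show ?thesis
    using B(1) C(1) a_pos by (intro exI[of _ "(B + C) / a"]) simp
qed

lemma N_ratio_error_integrable:
  "(\<integral>\<^sup>+z. ennreal \<bar>N_ratio z / a - indicator {0<..} z\<bar> \<partial>lborel) < \<infinity>"
proof -
  let ?f = "\<lambda>x. \<bar>(N x - a * x) / x\<bar> / x"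
  have "\<bar>N_ratio z / a - indicator {0<..} z\<bar>
      \<le> 1 / a * (exp z * ?f (exp z) * indicator {0..} z)" for z
  proof (cases "z > 0")
    case True
    have "N_ratio z / a - 1 = 1 / a * ((N (exp z) - a * exp z) / exp z)"
      using a_pos by (simp add: N_ratio_def field_simps)
    then show ?thesis
      using True a_pos by (simp add: abs_mult)
  qed (use a_pos in \<open>simp add: N_ratio_nonpos\<close>)
  then have "(\<integral>\<^sup>+z. ennreal \<bar>N_ratio z / a - indicator {0<..} z\<bar> \<partial>lborel)
      \<le> (\<integral>\<^sup>+z. ennreal (1 / a * (exp z * ?f (exp z) * indicator {0..} z)) \<partial>lborel)"
    by (intro nn_integral_mono ennreal_leI)
  also have "\<dots>
      = (\<integral>\<^sup>+z. ennreal (1 / a) * (ennreal (exp z * ?f (exp z)) * indicator {0..} z) \<partial>lborel)"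
    using a_pos by (intro nn_integral_cong) (simp flip: ennreal_mult' split: split_indicator)
  also have "\<dots> = ennreal (1 / a) * (\<integral>\<^sup>+z\<in>{0..}. ennreal (exp z * ?f (exp z)) \<partial>lborel)"
    by (simp add: nn_integral_cmult)
  also have "\<dots> < \<infinity>"
    using nn_integral_exp_substitution_finite[OF error_integrable]
    by (simp add: ennreal_mult_less_top)
  finally show ?thesis .
qed

lemma nn_integral_normalized_N_ratio:
  "(\<integral>\<^sup>+v. ennreal (N_ratio (u - v) / a) \<partial>prime_power_measure)
    = ennreal (log_sum (exp u) / (a * exp u))"
proof -
  have "(\<integral>\<^sup>+v. ennreal (N_ratio (u - v) / a) \<partial>prime_power_measure)
      = (\<integral>\<^sup>+v. ennreal (1 / a) * ennreal (N_ratio (u - v)) \<partial>prime_power_measure)"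
    using a_pos by (intro nn_integral_cong) (simp flip: ennreal_mult')
  also have "\<dots> = ennreal (1 / a) * ennreal (log_sum (exp u) / exp u)"
    by (simp add: nn_integral_cmult nn_integral_N_ratio_prime_power_measure)
  also have "\<dots> = ennreal (log_sum (exp u) / (a * exp u))"
    using a_pos by (simp flip: ennreal_mult')
  finally show ?thesis .
qed

lemma renewal_measure_prime_power_measure:
  "\<exists>m B D. renewal_measure prime_power_measure (\<lambda>z. N_ratio z / a) m B D"
proof -
  obtain m where m: "m > 0" "\<And>z. z > 0 \<Longrightarrow> m \<le> N_ratio z"
    using N_ratio_lower by blast
  obtain B where B: "B \<ge> 0" "\<And>u. \<bar>log_sum (exp u) / (a * exp u) - max 0 u\<bar> \<le> B"
    using log_sum_approx by blast
  obtain D where D: "D \<ge> 0"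
    "(\<integral>\<^sup>+z. ennreal \<bar>N_ratio z / a - indicator {0<..} z\<bar> \<partial>lborel) = ennreal D"
    using N_ratio_error_integrable unfolding infinity_ennreal_def less_top_ennreal by blast
  have "renewal_measure prime_power_measure (\<lambda>z. N_ratio z / a) (m / a) B D"
  proof
    fix u
    have "ennreal (log_sum (exp u) / (a * exp u)) \<le> ennreal (max 0 u + B)"
      using B(2)[of u] by (intro ennreal_leI) linarith
    then show "(\<integral>\<^sup>+v. ennreal (N_ratio (u - v) / a) \<partial>prime_power_measure)
        \<le> ennreal (max 0 u) + ennreal B"
      using B(1) by (simp add: nn_integral_normalized_N_ratio)
    have "ennreal (max 0 u) \<le> ennreal (log_sum (exp u) / (a * exp u) + B)"
      using B(2)[of u] by (intro ennreal_leI) linarith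
    then show "ennreal (max 0 u)
        \<le> (\<integral>\<^sup>+v. ennreal (N_ratio (u - v) / a) \<partial>prime_power_measure) + ennreal B"
      using B(1) a_pos log_sum_nonneg by (simp add: nn_integral_normalized_N_ratio)
  qed (use a_pos m B(1) D in \<open>simp_all add: N_ratio_nonpos divide_right_mono\<close>)
  then show ?thesis
    by blast
qed

theorem chebyshev_bounds: "\<exists>c>0. \<exists>C. \<forall>\<^sub>F x in at_top. c \<le> \<psi> x / x \<and> \<psi> x / x \<le> C"
proof -
  obtain m B D where "renewal_measure prime_power_measure (\<lambda>z. N_ratio z / a) m B D"
    using renewal_measure_prime_power_measure by blast
  then obtain c C T where c: "c > 0"
    and bounds: "\<And>t. t \<ge> T \<Longrightarrow>
      ennreal c \<le> exp_conv prime_power_measure t \<and> exp_conv prime_power_measure t \<le> ennreal C"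
    using renewal_measure.exp_conv_mu_bounds by blast
  have "c \<le> \<psi> x / x \<and> \<psi> x / x \<le> max 0 C" if "x \<ge> exp T" for x
  proof -
    have "x > 0"
      using that exp_gt_zero[of T] by linarith
    moreover from this have "ln x \<ge> T"
      using that by (simp add: ln_ge_iff)
    ultimately show ?thesis
      using bounds[of "ln x"] psi_nonneg[of x] c
      by (auto simp: exp_conv_prime_power_measure ennreal_le_iff2)
  qed
  with c show ?thesis
    unfolding eventually_at_top_linorder by blast
qed

end

theorem theorem1:
  fixes p :: "nat \<Rightarrow> real" and a :: real
  assumes "beurling_primes p"
    and "a > 0"
    and "(\<lambda>x. \<bar>(beurling_N p x - a * x) / x\<bar> / x) integrable_on {1..}"
    and "(\<lambda>x. beurling_N p x - a * x) \<in> o[at_top](\<lambda>x. x / ln x)"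
  shows "0 < Liminf at_top (\<lambda>x. ereal (beurling_psi p x / x)) \<and>
         Limsup at_top (\<lambda>x. ereal (beurling_psi p x / x)) < \<infinity>"
proof -
  interpret beurling_density p a
    by unfold_locales (fact assms)+
  obtain c C where c: "c > 0"
    and bounds: "\<forall>\<^sub>F x in at_top. c \<le> beurling_psi p x / x \<and> beurling_psi p x / x \<le> C"
    using chebyshev_bounds by blast
  have "ereal c \<le> Liminf at_top (\<lambda>x. ereal (beurling_psi p x / x))"
    by (rule Liminf_bounded) (use bounds in eventually_elim, simp)
  moreover have "Limsup at_top (\<lambda>x. ereal (beurling_psi p x / x)) \<le> ereal C"
    by (rule Limsup_bounded) (use bounds in eventually_elim, simp)
  ultimately show ?thesis
    using c by (auto intro: order_less_le_trans[of 0 "ereal c"] order_le_less_trans[of _ "ereal C"])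
qed

end
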